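(* Let $D$ be an integer-valued random variable with $D\ge3$ a.s. and $\mathbb E(D^2\log D)<\infty$, and set $Y=1$ (deterministic). With $\lambda$ and $W$ as in the context, let $$\widehat D=1+\sum_{i=1}^{D}\mathbf 1_{\{\Lambda_i+\log W_i+\lambda<M\}},\qquad M=\max_{1\le i\le D}\left(\Lambda_i+\log W_i-\lambda\right),$$ where $D$, $(\Lambda_i)_{i\ge1}$, $(W_i)_{i\ge1}$ are independent, the $\Lambda_i$ being i.i.d. standard Gumbel variables and the $W_i$ i.i.d. copies of $W$. Then the law of $\widehat D$ is equal to the limiting degree distribution for the breadth-first search tree; that is, writing $f(z)=\mathbb E(z^D)$, for all $z\in[0,1]$, $$\mathbb E\big(z^{\widehat D}\big)=z\int_0^1 f'\!\left(t-(1-z)\,\frac{f'\!\left(\frac{f'(t)}{f'(1)}\right)}{f'(1)}\right)dt .$$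
   Context: A standard Gumbel variable satisfies $\mathbb P(\Lambda\le x)=\exp(-e^{-x})$. The size-biased variable $D^\star$ has $\mathbb P(D^\star=k)=k\,\mathbb P(D=k)/\mathbb E(D)$; $\nu=\mathbb E(D^\star-1)$, and $\lambda$ is defined by $\nu\,\mathbb E(e^{-\lambda Y})=1$, i.e. $e^{-\lambda}=1/\nu$. The law of $W$ is the unique one with $W>0$ a.s., $\mathbb E(W)=1$ and $W\overset{d}{=}\sum_{i=1}^{D^\star-1}e^{-\lambda}W_i$, where $W_1,W_2,\dots$ are i.i.d. copies of $W$ independent of $D^\star$. The limiting degree distribution for the breadth-first search tree on the configuration model with degree distribution $D$ (known from earlier literature) is the probability distribution whose generating function is the right-hand side of the displayed formula. *)

theory Defs
  imports "HOL-Probability.Probability"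
begin

text \<open>Throughout, \<open>N\<close> stands for the law of \<open>D\<close>, a probability measure on
  \<open>count_space UNIV\<close>.\<close>

definition size_biased :: "nat measure \<Rightarrow> nat measure" where
  "size_biased N =
     density (count_space UNIV)
       (\<lambda>k. ennreal (real k * measure N {k} / (\<integral>j. real j \<partial>N)))"

text \<open>The constant \<open>\<nu>\<close>; the summand is a real subtraction, not a truncated one.\<close>

definition mean_offspring :: "nat measure \<Rightarrow> real" where
  "mean_offspring N = (\<integral>k. (real k - 1) \<partial>size_biased N)"

text \<open>\<open>\<mu>\<close> is the law of \<open>W\<close>. The last conjunct is the equation in distribution: under the
  product measure the coordinates \<open>w i\<close> are i.i.d. with law \<open>\<mu>\<close> and independent of the
  size-biased variable \<open>k\<close>. The subtraction \<open>k - 1\<close> is harmless because the size-biased law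
  does not charge 0.\<close>

definition W_law :: "nat measure \<Rightarrow> real \<Rightarrow> real measure \<Rightarrow> bool" where
  "W_law N lam \<mu> \<longleftrightarrow>
     prob_space \<mu> \<and> sets \<mu> = sets borel \<and>
     (AE w in \<mu>. 0 < w) \<and>
     integrable \<mu> (\<lambda>w. w) \<and> (\<integral>w. w \<partial>\<mu>) = 1 \<and>
     distr (size_biased N \<Otimes>\<^sub>M (\<Pi>\<^sub>M i\<in>(UNIV :: nat set). \<mu>)) borel
       (\<lambda>(k, w). \<Sum>i<k - 1. exp (- lam) * w i) = \<mu>"

definition tree_degree :: "real \<Rightarrow> nat \<Rightarrow> (nat \<Rightarrow> real) \<Rightarrow> (nat \<Rightarrow> real) \<Rightarrow> nat" where
  "tree_degree lam d L w =
     1 + (\<Sum>i<d. of_bool (L i + ln (w i) + lam < (MAX j\<in>{..<d}. L j + ln (w j) - lam)))"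

definition pgf :: "nat measure \<Rightarrow> real \<Rightarrow> real" where
  "pgf N z = (\<integral>k. z ^ k \<partial>N)"

text \<open>The derivative is taken within the unit interval, hence one-sided at the end points: the
  generating function need not be defined to the right of 1.\<close>

definition pgf' :: "nat measure \<Rightarrow> real \<Rightarrow> real" where
  "pgf' N t = vector_derivative (pgf N) (at t within {0..1})"

definition bfs_degree_pgf :: "nat measure \<Rightarrow> real \<Rightarrow> real" where
  "bfs_degree_pgf N z =
     z * (LBINT t:{0..1}.
            pgf' N (t - (1 - z) * (pgf' N (pgf' N t / pgf' N 1) / pgf' N 1)))"

definition bfs_degree_law :: "nat measure \<Rightarrow> nat pmf" where
  "bfs_degree_law N = (THE q. \<forall>z\<in>{0..1}. pgf (measure_pmf q) z = bfs_degree_pgf N z)"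

text \<open>Indices for the joint family consisting of \<open>D\<close>, the \<open>\<Lambda> i\<close> and the \<open>W i\<close>.\<close>

datatype var_index = Deg | Gumbel nat | Weight nat

end

theory Submission
  imports Defs "HOL-Complex_Analysis.Cauchy_Integral_Formula"
begin

text \<open>Let \<open>X\<^sub>i = \<Lambda>\<^sub>i + log W\<^sub>i\<close> and let \<open>\<phi>\<close> be the Laplace transform of \<open>W\<close>. Conditioning on \<open>W\<^sub>i\<close>
  shows that \<open>X\<^sub>i\<close> has the continuous, strictly increasing distribution function
  \<open>\<psi>(x) = \<phi>(e\<^bsup>-x\<^esup>)\<close>, so the variables \<open>V\<^sub>i = \<psi>(X\<^sub>i)\<close> are i.i.d. uniform on \<open>[0, 1]\<close>. The fixed-point
  equation for \<open>W\<close> says \<open>\<phi>(e\<^bsup>\<lambda>\<^esup> s) = F(\<phi>(s))\<close> with \<open>F = f'/f'(1)\<close>, hence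
  \<open>X\<^sub>i + \<lambda> < max\<^sub>j (X\<^sub>j - \<lambda>)\<close> means \<open>V\<^sub>i < F(F(max\<^sub>j V\<^sub>j))\<close>. Conditioning on the position
  and on the value \<open>t\<close> of the maximum, each of the other \<open>D - 1\<close> variables is at most \<open>t\<close> and
  contributes a factor \<open>z\<close> if it falls below \<open>F(F(t))\<close>, whence
  \<open>D (t - (1 - z) F(F(t)))\<^bsup>D-1\<^esup>\<close>, to be integrated over \<open>t\<close> and averaged over \<open>D\<close>.\<close>

section \<open>Probability generating functions determine the law\<close>

lemma pgf_pmf_sums:
  fixes p :: "nat pmf"
  assumes "norm z \<le> 1"
  shows "(\<lambda>k. pmf p k * z ^ k) sums pgf (measure_pmf p) z"
proof -
  have int: "integrable (measure_pmf p) (\<lambda>k. z ^ k)"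
    using assms by (intro measure_pmf.integrable_const_bound[where B = 1]) (auto simp: power_abs power_le_one)
  have "integrable (count_space UNIV) (\<lambda>k. pmf p k *\<^sub>R z ^ k)"
    using int by (subst (asm) measure_pmf_eq_density) (simp add: integrable_density)
  note sums_integral_count_space_nat[OF this]
  also have "(\<integral>k. pmf p k *\<^sub>R z ^ k \<partial>count_space UNIV) = pgf (measure_pmf p) z"
    unfolding pgf_def by (subst measure_pmf_eq_density) (rule integral_density[symmetric]; simp)
  finally show ?thesis
    by simp
qed

text \<open>The difference of the two generating functions is a power series near 0. If it had a
  nonzero coefficient, its zero at 0 would be isolated, yet it vanishes on all of [0, 1].\<close>

lemma pgf_inject:
  fixes p q :: "nat pmf"
  assumes eq: "\<And>z. 0 \<le> z \<Longrightarrow> z \<le> 1 \<Longrightarrow> pgf p z = pgf q z"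
  shows "p = q"
proof (rule ccontr)
  assume "p \<noteq> q"
  define a where "a k = pmf p k - pmf q k" for k
  have a_sums: "(\<lambda>k. a k * z ^ k) sums (pgf p z - pgf q z)" if "norm z \<le> 1" for z
    using sums_diff[OF pgf_pmf_sums[OF that] pgf_pmf_sums[OF that]]
    by (simp add: a_def algebra_simps)
  \<comment> \<open>Evaluation at 0 settles the constant term, so the nonzero coefficient has a
    positive index, as \<open>powser_0_nonzero\<close> demands.\<close>
  have "a 0 = 0"
    using powser_sums_zero_iff[of a "pgf p 0 - pgf q 0"] a_sums[of 0] eq[of 0] by simp
  moreover from \<open>p \<noteq> q\<close> obtain m where "a m \<noteq> 0"
    by (auto simp: a_def intro: pmf_eqI)
  ultimately have "0 < m"
    by (cases m) auto
  obtain s where "0 < s" and nz: "\<And>z. z \<in> cball 0 s - {0} \<Longrightarrow> pgf p z - pgf q z \<noteq> 0"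
    using powser_0_nonzero[of 1 0 a "\<lambda>z. pgf p z - pgf q z", OF _ _ _ \<open>a m \<noteq> 0\<close> \<open>0 < m\<close>]
      a_sums eq[of 0] by auto
  then show False
    \<comment> \<open>The point \<open>min s 1\<close> lies both in the punctured ball without zeros
      and in the unit interval.\<close>
    using nz[of "min s 1"] eq[of "min s 1"] by auto
qed

section \<open>Uniform variables below a function of their maximum\<close>

text \<open>The law lives on the whole Borel line, so that it can be the image of a real random
  variable under \<open>distr\<close>; membership in [0, 1] then holds only almost
  everywhere.\<close>

definition unit_uniform :: "real measure" where
  "unit_uniform = density lborel (\<lambda>t. indicator {0..1} t)"

lemma sets_unit_uniform [simp, measurable_cong]: "sets unit_uniform = sets borel"
  by (simp add: unit_uniform_def)

lemma space_unit_uniform [simp]: "space unit_uniform = UNIV"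
  by (simp add: unit_uniform_def)

lemma prob_space_unit_uniform: "prob_space unit_uniform"
  by (rule prob_spaceI) (simp add: unit_uniform_def emeasure_density)

lemma AE_unit_uniform: "AE t in unit_uniform. t \<in> {0..1}"
  unfolding unit_uniform_def by (subst AE_density) (auto split: split_indicator)

lemma integral_unit_uniform:
  fixes f :: "real \<Rightarrow> real"
  assumes [measurable]: "f \<in> borel_measurable borel"
  shows "(\<integral>t. f t \<partial>unit_uniform) = (LBINT t:{0..1}. f t)"
proof -
  have *: "unit_uniform = density lborel (\<lambda>t. ennreal (indicator {0..1} t))"
    by (simp add: unit_uniform_def ennreal_indicator)
  show ?thesis
    unfolding set_lebesgue_integral_def * by (subst integral_density) auto
qed

text \<open>Ties are broken by the flag \<open>s\<close>, so that the first maximal coordinate is the only one that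
  survives in \<open>power_card_eq_sum_weights\<close>.\<close>

definition weight :: "(real \<Rightarrow> real) \<Rightarrow> real \<Rightarrow> bool \<Rightarrow> real \<Rightarrow> real \<Rightarrow> real" where
  "weight g z s t x = (if x < t \<or> s \<and> x = t then if x < g t then z else 1 else 0)"

lemma weight_bounds: "0 \<le> z \<Longrightarrow> z \<le> 1 \<Longrightarrow> 0 \<le> weight g z s t x \<and> weight g z s t x \<le> 1"
  by (simp add: weight_def)

lemma measurable_weight [measurable]:
  assumes [measurable]: "g \<in> borel_measurable borel" "f \<in> borel_measurable M" "h \<in> borel_measurable M"
  shows "(\<lambda>x. weight g z s (f x) (h x)) \<in> borel_measurable M"
  unfolding weight_def by measurable

text \<open>The integrand is z on [0, g t) and 1 on [g t, t). The tie x = t is a null set, so the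
  flag \<open>s\<close> has no effect on the integral.\<close>

lemma integral_weight:
  assumes t: "t \<in> {0..1}" and g: "0 \<le> g t" "g t \<le> t"
  shows "(\<integral>x. weight g z s t x \<partial>unit_uniform) = t - (1 - z) * g t"
proof -
  let ?h = "\<lambda>x. z * indicator {0..<g t} x + indicator {g t..t} x :: real"
  have "(\<integral>x. weight g z s t x \<partial>unit_uniform) = (LBINT x:{0..1}. weight g z s t x)"
    by (rule integral_unit_uniform) (simp add: weight_def)
  also have "\<dots> = (\<integral>x. ?h x \<partial>lborel)"
    unfolding set_lebesgue_integral_def
  proof (rule integral_cong_AE)
    show "AE x in lborel. indicat_real {0..1} x *\<^sub>R weight g z s t x = ?h x"
      using AE_lborel_singleton[of t]
      by eventually_elim (use t g in \<open>auto simp: weight_def indicator_def\<close>)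
    show "(\<lambda>x. indicator {0..1} x *\<^sub>R weight g z s t x) \<in> borel_measurable lborel"
      by (simp add: weight_def)
  qed simp
  also have "\<dots> = z * g t + (t - g t)"
    using g by (subst Bochner_Integration.integral_add) auto
  finally show ?thesis
    by (simp add: algebra_simps)
qed

text \<open>The sum runs over the candidates \<open>i\<close> for the first maximal coordinate. Only
  the true one, \<open>k\<close>, gives a nonzero product, and in that product each other coordinate
  contributes z or 1 according to the threshold.\<close>

lemma power_card_eq_sum_weights:
  fixes v :: "nat \<Rightarrow> real"
  assumes d: "0 < d" and g: "\<And>i. i < d \<Longrightarrow> g (v i) \<le> v i"
  shows "z ^ card {i\<in>{..<d}. v i < g (MAX j\<in>{..<d}. v j)} =
    (\<Sum>i<d. \<Prod>j\<in>{..<d} - {i}. weight g z (i < j) (v i) (v j))"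
proof -
  define m where "m = (MAX j\<in>{..<d}. v j)"
  have ne: "v ` {..<d} \<noteq> {}"
    using d by auto
  have le: "v j \<le> m" if "j < d" for j
    using that by (auto simp: m_def)
  define k where "k = (LEAST i. i < d \<and> v i = m)"
  have "\<exists>i. i < d \<and> v i = m"
    using Max_in[OF _ ne] by (auto simp: m_def)
  from LeastI_ex[OF this] have k: "k < d" "v k = m"
    by (simp_all add: k_def)
  have below: "v j < m" if "j < k" for j
  proof -
    have "\<not> (j < d \<and> v j = m)"
      using not_less_Least that unfolding k_def .
    with that k le[of j] show ?thesis
      by simp
  qed
  have "(\<Sum>i<d. \<Prod>j\<in>{..<d} - {i}. weight g z (i < j) (v i) (v j)) =
      (\<Sum>i\<in>{k}. \<Prod>j\<in>{..<d} - {i}. weight g z (i < j) (v i) (v j))"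
  proof (rule sum.mono_neutral_right)
    show "\<forall>i\<in>{..<d} - {k}. (\<Prod>j\<in>{..<d} - {i}. weight g z (i < j) (v i) (v j)) = 0"
    proof
      fix i assume i: "i \<in> {..<d} - {k}"
      \<comment> \<open>The factor at \<open>k\<close> kills the product: \<open>v k\<close> is
        maximal, and in case of a tie with \<open>v i\<close> the index \<open>k\<close> comes
        first, so the flag is false.\<close>
      then have "weight g z (i < k) (v i) (v k) = 0"
        using le[of i] below[of i] k by (cases "i < k") (auto simp: weight_def)
      with i k show "(\<Prod>j\<in>{..<d} - {i}. weight g z (i < j) (v i) (v j)) = 0"
        by (intro prod_zero) auto
    qed
  qed (use k in auto)
  also have "\<dots> = (\<Prod>j\<in>{..<d} - {k}. if v j < g m then z else 1)"
  proof -
    have "weight g z (k < j) (v k) (v j) = (if v j < g m then z else 1)"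
      if "j \<in> {..<d} - {k}" for j
      using that le[of j] below[of j] k by (cases "k < j") (auto simp: weight_def)
    then have "(\<Prod>j\<in>{..<d} - {k}. weight g z (k < j) (v k) (v j)) =
        (\<Prod>j\<in>{..<d} - {k}. if v j < g m then z else 1)"
      by (rule prod.cong[OF refl])
    then show ?thesis
      by simp
  qed
  also have "\<dots> = z ^ card {j\<in>{..<d} - {k}. v j < g m}"
    by (subst prod.If_cases) (auto simp: Int_def)
  \<comment> \<open>The maximal coordinate is itself never counted, because g m \<le> m.\<close>
  also have "{j\<in>{..<d} - {k}. v j < g m} = {j\<in>{..<d}. v j < g m}"
    using k g[of k] by auto
  finally show ?thesis
    by (simp add: m_def)
qed

text \<open>Given that coordinate \<open>i\<close> has the value t, the other coordinates are
  independent and each contributes the factor computed in \<open>integral_weight\<close>.\<close>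

lemma integral_prod_weights:
  assumes J: "finite J" "i \<notin> J" and z: "0 \<le> z" "z \<le> 1"
    and [measurable]: "g \<in> borel_measurable borel"
    and g: "\<And>t. t \<in> {0..1} \<Longrightarrow> 0 \<le> g t \<and> g t \<le> t"
  shows "(\<integral>v. (\<Prod>j\<in>J. weight g z (s j) (v i) (v j)) \<partial>PiM (insert i J) (\<lambda>_. unit_uniform)) =
    (\<integral>t. (t - (1 - z) * g t) ^ card J \<partial>unit_uniform)"
proof -
  interpret U: prob_space unit_uniform
    by (rule prob_space_unit_uniform)
  interpret P: product_prob_space "\<lambda>_. unit_uniform" UNIV ..
  interpret PJ: prob_space "PiM J (\<lambda>_. unit_uniform)"
    by (intro prob_space_PiM prob_space_unit_uniform)
  interpret PI: prob_space "PiM (insert i J) (\<lambda>_. unit_uniform)"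
    by (intro prob_space_PiM prob_space_unit_uniform)
  interpret pair_prob_space "PiM J (\<lambda>_. unit_uniform)" unit_uniform ..
  have bound: "norm (\<Prod>j\<in>J. weight g z (s j) (v i) (v' j)) \<le> 1" for v v' :: "'a \<Rightarrow> real"
    using z by (auto simp: abs_prod weight_bounds intro!: prod_le_1)
  have bound': "norm (\<Prod>j\<in>J. weight g z (s j) t (v' j)) \<le> 1" for t and v' :: "'a \<Rightarrow> real"
    using z by (auto simp: abs_prod weight_bounds intro!: prod_le_1)
  have m1: "(\<lambda>v. \<Prod>j\<in>J. weight g z (s j) (v i) (v j)) \<in> borel_measurable (PiM (insert i J) (\<lambda>_. unit_uniform))"
    using J by (intro borel_measurable_prod measurable_weight) auto
  have m2: "(\<lambda>(x, t). \<Prod>j\<in>J. weight g z (s j) t (x j))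
      \<in> borel_measurable (PiM J (\<lambda>_. unit_uniform) \<Otimes>\<^sub>M unit_uniform)"
    unfolding case_prod_beta by (intro borel_measurable_prod measurable_weight) auto
  have "(\<integral>v. (\<Prod>j\<in>J. weight g z (s j) (v i) (v j)) \<partial>PiM (insert i J) (\<lambda>_. unit_uniform)) =
      (\<integral>x. \<integral>t. (\<Prod>j\<in>J. weight g z (s j) ((x(i := t)) i) ((x(i := t)) j)) \<partial>unit_uniform \<partial>PiM J (\<lambda>_. unit_uniform))"
    using J bound m1 by (intro P.product_integral_insert PI.integrable_const_bound[where B = 1]) auto
  also have "\<dots> = (\<integral>x. \<integral>t. (\<Prod>j\<in>J. weight g z (s j) t (x j)) \<partial>unit_uniform \<partial>PiM J (\<lambda>_. unit_uniform))"
    using J by (intro Bochner_Integration.integral_cong prod.cong refl) auto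
  \<comment> \<open>The splitting of the product measure leaves coordinate \<open>i\<close>
    innermost; the order is swapped so that t is fixed while the others are integrated.\<close>
  also have "\<dots> = (\<integral>t. \<integral>x. (\<Prod>j\<in>J. weight g z (s j) t (x j)) \<partial>PiM J (\<lambda>_. unit_uniform) \<partial>unit_uniform)"
    using bound' m2 by (intro Fubini_integral[symmetric] P.integrable_const_bound[where B = 1]) auto
  also have "\<dots> = (\<integral>t. (\<Prod>j\<in>J. \<integral>x. weight g z (s j) t x \<partial>unit_uniform) \<partial>unit_uniform)"
    using J z by (intro Bochner_Integration.integral_cong refl P.product_integral_prod
      U.integrable_const_bound[where B = 1]) (auto simp: weight_bounds)
  also have "\<dots> = (\<integral>t. (t - (1 - z) * g t) ^ card J \<partial>unit_uniform)"
    using AE_unit_uniform by (intro integral_cong_AE) (auto simp: integral_weight g)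
  finally show ?thesis .
qed

text \<open>Each of the \<open>d\<close> possible positions of the maximum contributes the same
  integral, with d - 1 remaining coordinates.\<close>

lemma expectation_power_card_below:
  assumes d: "0 < d" and z: "0 \<le> z" "z \<le> 1"
    and [measurable]: "g \<in> borel_measurable borel"
    and g: "\<And>t. t \<in> {0..1} \<Longrightarrow> 0 \<le> g t \<and> g t \<le> t"
  shows "(\<integral>v. z ^ card {i\<in>{..<d}. v i < g (MAX j\<in>{..<d}. v j)} \<partial>PiM {..<d} (\<lambda>_. unit_uniform)) =
    d * (\<integral>t. (t - (1 - z) * g t) ^ (d - 1) \<partial>unit_uniform)"
    (is "(\<integral>v. ?f v \<partial>?P) = _")
proof -
  interpret P: prob_space ?P
    by (intro prob_space_PiM prob_space_unit_uniform)
  let ?w = "\<lambda>i v. \<Prod>j\<in>{..<d} - {i}. weight g z (i < j) (v i) (v j)"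
  have [measurable]: "?w i \<in> borel_measurable ?P" if "i < d" for i
    using that by (intro borel_measurable_prod measurable_weight) auto
  have int: "integrable ?P (?w i)" if "i < d" for i
    using that z by (intro P.integrable_const_bound[where B = 1])
      (auto simp: abs_prod weight_bounds intro!: prod_le_1)
  \<comment> \<open>The bound g t \<le> t is available only on [0, 1], so the pointwise
    decomposition holds almost everywhere.\<close>
  have "AE v in ?P. \<forall>i\<in>{..<d}. v i \<in> {0..1}"
    by (intro AE_finite_allI AE_PiM_component prob_space_unit_uniform AE_unit_uniform) auto
  then have "AE v in ?P. ?f v = (\<Sum>i<d. ?w i v)"
  proof eventually_elim
    case (elim v)
    with g show ?case
      by (intro power_card_eq_sum_weights[OF d]) auto
  qed
  then have "(\<integral>v. ?f v \<partial>?P) = (\<integral>v. (\<Sum>i<d. ?w i v) \<partial>?P)"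
    using d by (intro integral_cong_AE) (auto intro!: borel_measurable_sum)
  also have "\<dots> = (\<Sum>i<d. \<integral>v. ?w i v \<partial>?P)"
    using int by (intro Bochner_Integration.integral_sum) auto
  also have "\<dots> = (\<Sum>i<d. (\<integral>t. (t - (1 - z) * g t) ^ (d - 1) \<partial>unit_uniform))"
  proof (intro sum.cong refl)
    fix i assume "i \<in> {..<d}"
    then have "insert i ({..<d} - {i}) = {..<d}" "card ({..<d} - {i}) = d - 1"
      by auto
    with integral_prod_weights[of "{..<d} - {i}" i z g "\<lambda>j. i < j"] z g
    show "(\<integral>v. ?w i v \<partial>?P) = (\<integral>t. (t - (1 - z) * g t) ^ (d - 1) \<partial>unit_uniform)"
      by simp
  qed
  finally show ?thesis
    by simp
qed

section \<open>The generating function of the degree and its size-biased version\<close>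

locale degree_distribution = N: prob_space N for N :: "nat measure" +
  assumes sets_N [simp, measurable_cong]: "sets N = sets (count_space UNIV)"
    and ge_3: "AE k in N. 3 \<le> k"
    and integrable_N: "integrable N real"
begin

lemma space_N [simp]: "space N = UNIV"
  using sets_eq_imp_space_eq[OF sets_N] by simp

definition mean_degree :: real where
  "mean_degree = (\<integral>k. real k \<partial>N)"

text \<open>The termwise derivative of the generating function; \<open>pgf'_eq\<close> identifies it
  with \<open>pgf'\<close> on [0, 1].\<close>

definition pgf_deriv :: "real \<Rightarrow> real" where
  "pgf_deriv t = (\<integral>k. real k * t ^ (k - 1) \<partial>N)"

text \<open>The function F of the opening comment, which is the generating function of the
  size-biased degree minus one, see \<open>integral_size_biased_power\<close>.\<close>

definition biased_pgf :: "real \<Rightarrow> real" where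
  "biased_pgf t = pgf_deriv t / mean_degree"

lemma measurable_N [simp]: "f \<in> measurable N M \<longleftrightarrow> f \<in> UNIV \<rightarrow> space M"
  by (simp add: measurable_cong_sets[OF sets_N refl])

lemma mean_degree_pos: "0 < mean_degree"
proof -
  have "(\<integral>k. 3 \<partial>N) \<le> mean_degree"
    unfolding mean_degree_def using ge_3 integrable_N by (intro integral_mono_AE) auto
  then show ?thesis
    using N.prob_space by simp
qed

lemma integrable_deriv_terms:
  assumes "t \<in> {0..1}"
  shows "integrable N (\<lambda>k. real k * t ^ (k - 1))"
  using assms by (intro Bochner_Integration.integrable_bound[OF integrable_N])
    (auto simp: abs_mult power_abs intro!: mult_left_le power_le_one)

lemma pgf_deriv_nonneg: "0 \<le> t \<Longrightarrow> 0 \<le> pgf_deriv t"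
  unfolding pgf_deriv_def by (intro integral_nonneg_AE) auto

lemma pgf_deriv_1: "pgf_deriv 1 = mean_degree"
  by (simp add: pgf_deriv_def mean_degree_def)

lemma biased_pgf_nonneg: "0 \<le> t \<Longrightarrow> 0 \<le> biased_pgf t"
  using mean_degree_pos pgf_deriv_nonneg by (simp add: biased_pgf_def)

text \<open>As k \<ge> 3, the exponent k - 1 is at least 1, so each power is at most t. Applied
  twice, this makes F(F(t)) an admissible threshold function g.\<close>

lemma biased_pgf_le:
  assumes t: "t \<in> {0..1}"
  shows "biased_pgf t \<le> t"
proof -
  have "AE k in N. real k * t ^ (k - 1) \<le> t * real k"
    using ge_3
  proof eventually_elim
    case (elim k)
    then have "t ^ (k - 1) \<le> t ^ 1"
      using t by (intro power_decreasing) auto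
    then show ?case
      using mult_left_mono[of "t ^ (k - 1)" t "real k"] by (simp add: mult.commute)
  qed
  then have "pgf_deriv t \<le> (\<integral>k. t * real k \<partial>N)"
    unfolding pgf_deriv_def using integrable_deriv_terms[OF t] integrable_N
    by (intro integral_mono_AE) auto
  also have "\<dots> = t * mean_degree"
    by (simp add: mean_degree_def)
  finally show ?thesis
    using mean_degree_pos by (simp add: biased_pgf_def divide_simps)
qed

lemma biased_pgf_mem: "t \<in> {0..1} \<Longrightarrow> biased_pgf t \<in> {0..1}"
  using biased_pgf_nonneg[of t] biased_pgf_le[of t] by auto

lemma measurable_pgf_deriv [measurable]: "pgf_deriv \<in> borel_measurable borel"
proof -
  have "(\<lambda>(t, k). real k * t ^ (k - 1)) \<in> borel_measurable (borel \<Otimes>\<^sub>M N)"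
  proof -
    have "(\<lambda>(t, k). real k * t ^ (k - 1)) \<in> borel_measurable (borel \<Otimes>\<^sub>M count_space UNIV)"
      by measurable
    then show ?thesis
      by (subst measurable_cong_sets[OF sets_pair_measure_cong[OF refl sets_N] refl])
  qed
  then show ?thesis
    unfolding pgf_deriv_def by (rule N.borel_measurable_lebesgue_integral)
qed

lemma measurable_biased_pgf [measurable]: "biased_pgf \<in> borel_measurable borel"
  unfolding biased_pgf_def by measurable

text \<open>Differentiation under the expectation: on the unit interval the difference quotients of
  the k-th power are bounded by k, which is integrable, so dominated convergence applies, also at
  the end points.\<close>

lemma pgf'_eq:
  assumes t: "t \<in> {0..1}"
  shows "pgf' N t = pgf_deriv t"
proof -
  have int: "integrable N (\<lambda>k. y ^ k)" if "y \<in> {0..1}" for y :: real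
    using that by (intro N.integrable_const_bound[where B = 1]) (auto simp: power_abs power_le_one)
  have "((\<lambda>y. (pgf N y - pgf N t) / (y - t)) \<longlongrightarrow> pgf_deriv t) (at t within {0..1})"
    unfolding tendsto_at_iff_sequentially comp_def
  proof (intro allI impI)
    fix y :: "nat \<Rightarrow> real"
    assume y: "\<forall>i. y i \<in> {0..1} - {t}" and lim: "y \<longlonglongrightarrow> t"
    have "(\<lambda>n. \<integral>k. (y n ^ k - t ^ k) / (y n - t) \<partial>N) \<longlonglongrightarrow> pgf_deriv t"
      unfolding pgf_deriv_def
    proof (rule integral_dominated_convergence)
      show "integrable N real"
        by (rule integrable_N)
      show "AE k in N. (\<lambda>n. (y n ^ k - t ^ k) / (y n - t)) \<longlonglongrightarrow> real k * t ^ (k - 1)"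
      proof (rule AE_I2)
        fix k
        have "((\<lambda>x. x ^ k) has_field_derivative real k * t ^ (k - 1)) (at t)"
          using DERIV_pow[of k t UNIV] by simp
        then have "((\<lambda>x. (x ^ k - t ^ k) / (x - t)) \<longlongrightarrow> real k * t ^ (k - 1)) (at t)"
          by (simp add: has_field_derivative_iff)
        then show "(\<lambda>n. (y n ^ k - t ^ k) / (y n - t)) \<longlonglongrightarrow> real k * t ^ (k - 1)"
          using y lim unfolding tendsto_at_iff_sequentially comp_def by auto
      qed
      show "AE k in N. norm ((y n ^ k - t ^ k) / (y n - t)) \<le> real k" for n
      proof (rule AE_I2)
        fix k
        have "norm (y n ^ k - t ^ k) \<le> real k * norm (y n - t)"
          using y t by (intro norm_power_diff) auto
        then show "norm ((y n ^ k - t ^ k) / (y n - t)) \<le> real k"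
          using y by (simp add: abs_divide divide_simps)
      qed
    qed auto
    moreover have "(\<integral>k. (y n ^ k - t ^ k) / (y n - t) \<partial>N) = (pgf N (y n) - pgf N t) / (y n - t)" for n
    proof -
      have "y n \<in> {0..1}"
        using y by auto
      with t show ?thesis
        by (simp add: pgf_def int)
    qed
    ultimately show "(\<lambda>n. (pgf N (y n) - pgf N t) / (y n - t)) \<longlonglongrightarrow> pgf_deriv t"
      by (simp only:)
  qed
  then have "(pgf N has_vector_derivative pgf_deriv t) (at t within {0..1})"
    by (simp add: has_field_derivative_iff flip: has_real_derivative_iff_has_vector_derivative)
  with t show ?thesis
    unfolding pgf'_def by (intro vector_derivative_within_closed_interval) auto
qed

text \<open>With \<open>N\<close> in place of counting measure as the base, size-biased integrals
  become expectations under the law of D.\<close>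

lemma size_biased_eq_density: "size_biased N = density N (\<lambda>k. ennreal (real k / mean_degree))"
proof (rule measure_eqI_countable[where A = UNIV])
  fix k :: nat
  have "emeasure (size_biased N) {k} = ennreal (real k * measure N {k} / mean_degree)"
    by (simp add: size_biased_def mean_degree_def emeasure_density)
  also have "\<dots> = ennreal (real k / mean_degree) * emeasure N {k}"
    using mean_degree_pos by (simp add: N.emeasure_eq_measure flip: ennreal_mult)
  also have "\<dots> = emeasure (density N (\<lambda>k. ennreal (real k / mean_degree))) {k}"
    by (simp add: emeasure_density nn_integral_indicator_singleton)
  finally show "emeasure (size_biased N) {k} = emeasure (density N (\<lambda>k. ennreal (real k / mean_degree))) {k}" .
qed (auto simp: size_biased_def)

lemma prob_space_size_biased: "prob_space (size_biased N)"
proof (rule prob_spaceI)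
  have "emeasure (size_biased N) (space (size_biased N)) = (\<integral>\<^sup>+k. ennreal (real k / mean_degree) \<partial>N)"
    by (simp add: size_biased_eq_density emeasure_density)
  also have "\<dots> = ennreal (\<integral>k. real k / mean_degree \<partial>N)"
    using integrable_N mean_degree_pos by (intro nn_integral_eq_integral) auto
  also have "\<dots> = 1"
    using mean_degree_pos by (simp add: mean_degree_def)
  finally show "emeasure (size_biased N) (space (size_biased N)) = 1" .
qed

lemma integral_size_biased_power: "(\<integral>k. t ^ (k - 1) \<partial>size_biased N) = biased_pgf t"
proof -
  have "(\<integral>k. t ^ (k - 1) \<partial>size_biased N) = (\<integral>k. (real k / mean_degree) *\<^sub>R t ^ (k - 1) \<partial>N)"
    unfolding size_biased_eq_density using mean_degree_pos by (intro integral_density) auto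
  then show ?thesis
    by (simp add: biased_pgf_def pgf_deriv_def)
qed

end

section \<open>A random number of i.i.d. variables\<close>

lemma integral_PiM_restrict:
  fixes U :: "'a measure" and h :: "('i \<Rightarrow> 'a) \<Rightarrow> real"
  assumes U: "prob_space U" and J: "finite J"
    and h: "h \<in> borel_measurable (PiM J (\<lambda>_. U))"
  shows "(\<integral>w. h (restrict w J) \<partial>PiM UNIV (\<lambda>_. U)) = (\<integral>w. h w \<partial>PiM J (\<lambda>_. U))"
proof -
  interpret U: prob_space U by fact
  interpret P: product_prob_space "\<lambda>_. U" UNIV ..
  show ?thesis
    by (subst P.distr_PiM_restrict_finite[OF J subset_UNIV, symmetric], subst integral_distr)
      (auto intro: h measurable_restrict_subset)
qed

text \<open>Fubini fixes k, after which only a finite product remains. It is used with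
  \<open>n k\<close> = k - 1 for the fixed-point equation and with \<open>n k\<close> = k for the
  degree.\<close>

lemma integral_pair_PiM_nat:
  fixes U :: "'a measure" and h :: "nat \<Rightarrow> (nat \<Rightarrow> 'a) \<Rightarrow> real"
  assumes K: "prob_space K" "sets K = sets (count_space UNIV)" and U: "prob_space U"
    and h: "\<And>k. h k \<in> borel_measurable (PiM {..<n k} (\<lambda>_. U))"
    and bound: "\<And>k w. \<bar>h k w\<bar> \<le> B"
  shows "(\<integral>(k, w). h k (restrict w {..<n k}) \<partial>(K \<Otimes>\<^sub>M PiM UNIV (\<lambda>_. U))) =
    (\<integral>k. \<integral>w. h k w \<partial>PiM {..<n k} (\<lambda>_. U) \<partial>K)"
proof -
  interpret K: prob_space K by fact
  interpret U: prob_space U by fact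
  interpret P: prob_space "PiM UNIV (\<lambda>_ :: nat. U)"
    by (intro prob_space_PiM U)
  interpret KP: pair_prob_space K "PiM UNIV (\<lambda>_ :: nat. U)" ..
  \<comment> \<open>Since k ranges over a countable discrete space, measurability for each k gives
    joint measurability.\<close>
  have "(\<lambda>(k, w). h k (restrict w {..<n k})) \<in> borel_measurable (count_space UNIV \<Otimes>\<^sub>M PiM UNIV (\<lambda>_. U))"
    by (intro measurable_pair_measure_countable1)
      (auto intro!: measurable_compose[OF _ h] measurable_restrict_subset)
  then have meas: "(\<lambda>(k, w). h k (restrict w {..<n k})) \<in> borel_measurable (K \<Otimes>\<^sub>M PiM UNIV (\<lambda>_. U))"
    by (subst measurable_cong_sets[OF sets_pair_measure_cong[OF K(2) refl] refl])
  have "integrable (K \<Otimes>\<^sub>M PiM UNIV (\<lambda>_. U)) (\<lambda>(k, w). h k (restrict w {..<n k}))"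
    using meas bound by (intro KP.integrable_const_bound[where B = B]) auto
  from KP.integral_fst'[OF this] show ?thesis
    by (simp add: integral_PiM_restrict[OF U _ h])
qed

section \<open>The Laplace transform of W and the distribution function of \<Lambda> + log W\<close>

locale limit_weight = degree_distribution +
  fixes lam :: real and \<mu> :: "real measure"
  assumes W_law: "W_law N lam \<mu>"
begin

sublocale W: prob_space \<mu>
  using W_law by (simp add: W_law_def)

lemma sets_W [simp, measurable_cong]: "sets \<mu> = sets borel"
  using W_law by (simp add: W_law_def)

lemma W_pos: "AE w in \<mu>. 0 < w"
  using W_law by (simp add: W_law_def)

definition laplace :: "real \<Rightarrow> real" where
  "laplace s = (\<integral>w. exp (- (s * w)) \<partial>\<mu>)"

lemma integrable_exp_W: "0 \<le> s \<Longrightarrow> integrable \<mu> (\<lambda>w. exp (- (s * w)))"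
  using W_pos by (intro W.integrable_const_bound[where B = 1]) auto

lemma laplace_nonneg: "0 \<le> laplace s"
  by (simp add: laplace_def)

lemma laplace_le_1: "0 \<le> s \<Longrightarrow> laplace s \<le> 1"
  unfolding laplace_def using W_pos integrable_exp_W by (intro W.integral_le_const) auto

text \<open>Strictness comes from W > 0 almost surely; it is what makes \<psi> strictly
  increasing.\<close>

lemma laplace_strict_antimono:
  assumes "0 \<le> s" "s < t"
  shows "laplace t < laplace s"
  unfolding laplace_def
proof (rule W.integral_less_AE_space)
  show "AE w in \<mu>. exp (- (t * w)) < exp (- (s * w))"
    using W_pos by eventually_elim (use assms in auto)
qed (use assms W.emeasure_space_1 in \<open>auto intro!: integrable_exp_W\<close>)

lemma measurable_branching_sum:
  "(\<lambda>(k, w). \<Sum>i<k - 1. exp (- lam) * w i)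
    \<in> borel_measurable (size_biased N \<Otimes>\<^sub>M (\<Pi>\<^sub>M i\<in>(UNIV :: nat set). \<mu>))"
proof -
  have "(\<lambda>(k, w). \<Sum>i<k - 1. exp (- lam) * w i)
      \<in> borel_measurable (count_space UNIV \<Otimes>\<^sub>M (\<Pi>\<^sub>M i\<in>(UNIV :: nat set). \<mu>))"
    by (intro measurable_pair_measure_countable1) auto
  moreover have "sets (size_biased N) = sets (count_space UNIV)"
    by (simp add: size_biased_def)
  ultimately show ?thesis
    by (subst measurable_cong_sets[OF sets_pair_measure_cong[OF _ refl] refl])
qed

text \<open>In the equation in distribution the factors exp(\<lambda>) and exp(-\<lambda>) cancel.
  Given that the size-biased variable is k, independence yields the power k - 1 of
  \<open>laplace s\<close>, and averaging over k yields F.\<close>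

lemma laplace_rec:
  assumes s: "0 \<le> s"
  shows "laplace (exp lam * s) = biased_pgf (laplace s)"
proof -
  let ?S = "size_biased N \<Otimes>\<^sub>M (\<Pi>\<^sub>M i\<in>(UNIV :: nat set). \<mu>)"
  \<comment> \<open>\<open>\<mu>\<close> does not charge the negative numbers, but only \<open>min 1\<close> makes the integrand bounded there.\<close>
  have "laplace (exp lam * s) = (\<integral>w. min 1 (exp (- (exp lam * s * w))) \<partial>\<mu>)"
    unfolding laplace_def
  proof (rule integral_cong_AE)
    show "AE w in \<mu>. exp (- (exp lam * s * w)) = min 1 (exp (- (exp lam * s * w)))"
      using W_pos by eventually_elim (use s in auto)
  qed auto
  also have "\<dots> = (\<integral>w. min 1 (exp (- (exp lam * s * w)))
      \<partial>distr ?S borel (\<lambda>(k, w). \<Sum>i<k - 1. exp (- lam) * w i))"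
    using W_law by (simp add: W_law_def)
  also have "\<dots> = (\<integral>x. min 1 (exp (- (exp lam * s * (case x of (k, w) \<Rightarrow> \<Sum>i<k - 1. exp (- lam) * w i)))) \<partial>?S)"
    by (intro integral_distr measurable_branching_sum) auto
  \<comment> \<open>The sum sees only the first k - 1 coordinates; \<open>restrict\<close> records
    this in the form that \<open>integral_pair_PiM_nat\<close> expects.\<close>
  also have "\<dots> = (\<integral>(k, w). min 1 (\<Prod>i<k - 1. exp (- (s * restrict w {..<k - 1} i))) \<partial>?S)"
  proof (rule Bochner_Integration.integral_cong[OF refl], clarify)
    fix k and w :: "nat \<Rightarrow> real"
    have "exp lam * s * (\<Sum>i<k - 1. exp (- lam) * w i) = (\<Sum>i<k - 1. s * w i)"
      by (auto simp: sum_distrib_left exp_minus intro!: sum.cong)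
    then show "min 1 (exp (- (exp lam * s * (\<Sum>i<k - 1. exp (- lam) * w i)))) =
        min 1 (\<Prod>i<k - 1. exp (- (s * restrict w {..<k - 1} i)))"
      by (simp add: exp_sum flip: sum_negf)
  qed
  also have "\<dots> = (\<integral>k. \<integral>w. min 1 (\<Prod>i<k - 1. exp (- (s * w i)))
      \<partial>PiM {..<k - 1} (\<lambda>_. \<mu>) \<partial>size_biased N)"
  proof (rule integral_pair_PiM_nat[where B = 1])
    show "\<bar>min 1 (\<Prod>i<k - 1. exp (- (s * w i)))\<bar> \<le> 1" for k and w :: "nat \<Rightarrow> real"
      using prod_nonneg[of "{..<k - 1}" "\<lambda>i. exp (- (s * w i))"] by (auto simp: min_def)
    show "sets (size_biased N) = sets (count_space UNIV)"
      by (simp add: size_biased_def)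
  qed (use prob_space_size_biased W.prob_space_axioms in auto)
  also have "\<dots> = (\<integral>k. laplace s ^ (k - 1) \<partial>size_biased N)"
  proof (rule Bochner_Integration.integral_cong[OF refl])
    fix k :: nat
    interpret P: product_prob_space "\<lambda>_. \<mu>" UNIV ..
    have "AE w in PiM {..<k - 1} (\<lambda>_. \<mu>). \<forall>i\<in>{..<k - 1}. 0 < w i"
      by (intro AE_finite_allI AE_PiM_component W.prob_space_axioms W_pos) auto
    then have "AE w in PiM {..<k - 1} (\<lambda>_. \<mu>).
        min 1 (\<Prod>i<k - 1. exp (- (s * w i))) = (\<Prod>i<k - 1. exp (- (s * w i)))"
    proof eventually_elim
      case (elim w)
      have "0 \<le> s * w i" if "i < k - 1" for i
        using elim s that by (intro mult_nonneg_nonneg) (auto intro: less_imp_le)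
      then have "(\<Prod>i<k - 1. exp (- (s * w i))) \<le> 1"
        by (intro prod_le_1) auto
      then show ?case
        by (rule min.absorb2)
    qed
    then have "(\<integral>w. min 1 (\<Prod>i<k - 1. exp (- (s * w i))) \<partial>PiM {..<k - 1} (\<lambda>_. \<mu>)) =
        (\<integral>w. (\<Prod>i<k - 1. exp (- (s * w i))) \<partial>PiM {..<k - 1} (\<lambda>_. \<mu>))"
      by (intro integral_cong_AE) auto
    also have "\<dots> = (\<Prod>i<k - 1. laplace s)"
      unfolding laplace_def using s by (intro P.product_integral_prod integrable_exp_W) auto
    finally show "(\<integral>w. min 1 (\<Prod>i<k - 1. exp (- (s * w i))) \<partial>PiM {..<k - 1} (\<lambda>_. \<mu>)) =
        laplace s ^ (k - 1)"
      by simp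
  qed
  finally show ?thesis
    by (simp only: integral_size_biased_power)
qed

text \<open>This is \<psi>, a mixture over W of shifted Gumbel distribution functions.\<close>

definition gumbel_mix :: "real \<Rightarrow> real" where
  "gumbel_mix x = laplace (exp (- x))"

lemma gumbel_mix_strict_mono: "x < y \<Longrightarrow> gumbel_mix x < gumbel_mix y"
  by (simp add: gumbel_mix_def laplace_strict_antimono)

lemma gumbel_mix_less_iff: "gumbel_mix x < gumbel_mix y \<longleftrightarrow> x < y"
  using gumbel_mix_strict_mono by (metis linorder_less_linear order_less_asym)

lemma mono_gumbel_mix: "mono gumbel_mix"
  using gumbel_mix_less_iff by (intro monoI) (metis linorder_not_less)

lemma gumbel_mix_pos: "0 < gumbel_mix x"
  using gumbel_mix_strict_mono[of "x - 1" x] laplace_nonneg[of "exp (- (x - 1))"]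
  by (simp add: gumbel_mix_def)

lemma gumbel_mix_le_1: "gumbel_mix x \<le> 1"
  by (simp add: gumbel_mix_def laplace_le_1)

lemma continuous_gumbel_mix: "continuous_on UNIV gumbel_mix"
  unfolding continuous_on_sequentially comp_def
proof (intro ballI allI impI)
  fix x :: real and u :: "nat \<Rightarrow> real"
  assume "(\<forall>n. u n \<in> UNIV) \<and> u \<longlonglongrightarrow> x"
  then have "u \<longlonglongrightarrow> x"
    by simp
  then show "(\<lambda>n. gumbel_mix (u n)) \<longlonglongrightarrow> gumbel_mix x"
    unfolding gumbel_mix_def laplace_def
  proof (intro integral_dominated_convergence[where w = "\<lambda>_. 1"])
    show "AE w in \<mu>. norm (exp (- (exp (- u n) * w))) \<le> 1" for n
      using W_pos by eventually_elim auto
    assume "u \<longlonglongrightarrow> x"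
    then show "AE w in \<mu>. (\<lambda>n. exp (- (exp (- u n) * w))) \<longlonglongrightarrow> exp (- (exp (- x) * w))"
      by (intro AE_I2 tendsto_intros)
  qed auto
qed

lemma measurable_gumbel_mix [measurable]: "gumbel_mix \<in> borel_measurable borel"
  by (rule borel_measurable_continuous_onI[OF continuous_gumbel_mix])

text \<open>A shift by \<lambda> multiplies the Laplace argument by exp(\<lambda>), hence applies F.
  There are two shifts because the tree degree compares X + \<lambda> with a maximum of X -
  \<lambda>.\<close>

lemma gumbel_mix_shift: "gumbel_mix (x - 2 * lam) = biased_pgf (biased_pgf (gumbel_mix x))"
proof -
  have "exp (- (x - 2 * lam)) = exp lam * (exp lam * exp (- x))"
    by (simp flip: exp_add)
  then show ?thesis
    by (simp add: gumbel_mix_def laplace_rec)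
qed

text \<open>The increasing function \<psi> commutes with the maximum and preserves strict
  comparison, so the condition that X i is below the maximum minus 2\<lambda> can be read off after
  applying it to both sides.\<close>

lemma tree_degree_eq_card:
  "tree_degree lam d L w = 1 + card {i\<in>{..<d}. gumbel_mix (L i + ln (w i)) <
    biased_pgf (biased_pgf (MAX j\<in>{..<d}. gumbel_mix (L j + ln (w j))))}"
proof (cases "d = 0")
  case False
  define x where "x i = L i + ln (w i)" for i
  have ne: "x ` {..<d} \<noteq> {}"
    using False by auto
  have "(MAX j\<in>{..<d}. L j + ln (w j) - lam) = Max ((\<lambda>y. y - lam) ` x ` {..<d})"
    by (simp add: image_image x_def)
  also have "\<dots> = Max (x ` {..<d}) - lam"
    using ne by (subst mono_Max_commute[of "\<lambda>y. y - lam", symmetric]) (auto intro: monoI)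
  finally have 1: "(MAX j\<in>{..<d}. L j + ln (w j) - lam) = Max (x ` {..<d}) - lam" .
  have "(MAX j\<in>{..<d}. gumbel_mix (L j + ln (w j))) = Max (gumbel_mix ` x ` {..<d})"
    by (simp add: image_image x_def)
  also have "\<dots> = gumbel_mix (Max (x ` {..<d}))"
    using ne by (subst mono_Max_commute[OF mono_gumbel_mix]) auto
  finally have "biased_pgf (biased_pgf (MAX j\<in>{..<d}. gumbel_mix (L j + ln (w j)))) =
      gumbel_mix (Max (x ` {..<d}) - 2 * lam)"
    by (simp add: gumbel_mix_shift)
  then have "{i\<in>{..<d}. gumbel_mix (L i + ln (w i)) <
      biased_pgf (biased_pgf (MAX j\<in>{..<d}. gumbel_mix (L j + ln (w j))))} =
      {i\<in>{..<d}. L i + ln (w i) + lam < (MAX j\<in>{..<d}. L j + ln (w j) - lam)}"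
    unfolding 1 by (auto simp: gumbel_mix_less_iff x_def)
  then show ?thesis
    by (simp add: tree_degree_def of_bool_def sum.If_cases Int_def)
\<comment> \<open>For d = 0 the maximum over the empty set is unspecified, but nothing is compared
  with it and both sides are 1.\<close>
qed (simp add: tree_degree_def)

end

section \<open>Transformation to uniform variables\<close>

text \<open>Conditioning on Y = w turns the event into L \<le> x - ln w, to which the Gumbel
  distribution function applies; w > 0 gives exp(ln w) = w.\<close>

lemma (in prob_space) prob_gumbel_add_ln_le:
  fixes Y :: "'a \<Rightarrow> real"
  assumes ind: "indep_var borel L borel Y"
    and gumbel: "\<And>x. prob {\<omega> \<in> space M. L \<omega> \<le> x} = exp (- exp (- x))"
    and pos: "AE w in distr M borel Y. 0 < w"
  shows "prob {\<omega> \<in> space M. L \<omega> + ln (Y \<omega>) \<le> x} = (\<integral>w. exp (- (exp (- x) * w)) \<partial>distr M borel Y)"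
proof -
  have [measurable]: "random_variable borel L" "random_variable borel Y"
    using ind by (auto simp: indep_var_distribution_eq)
  have joint: "distr M borel L \<Otimes>\<^sub>M distr M borel Y = distr M (borel \<Otimes>\<^sub>M borel) (\<lambda>\<omega>. (L \<omega>, Y \<omega>))"
    using ind by (simp add: indep_var_distribution_eq)
  interpret L: prob_space "distr M borel L"
    by (rule prob_space_distr) simp
  interpret Y: prob_space "distr M borel Y"
    by (rule prob_space_distr) simp
  interpret P: pair_prob_space "distr M borel L" "distr M borel Y" ..
  let ?A = "{p \<in> space (borel \<Otimes>\<^sub>M borel). fst p + ln (snd p) \<le> x}"
  have A: "?A \<in> sets (borel \<Otimes>\<^sub>M borel)"
    by measurable
  have "emeasure M {\<omega> \<in> space M. L \<omega> + ln (Y \<omega>) \<le> x} = emeasure (distr M borel L \<Otimes>\<^sub>M distr M borel Y) ?A"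
    unfolding joint by (subst emeasure_distr[OF _ A]) (auto simp: space_pair_measure intro!: arg_cong[where f = "emeasure M"])
  also have "\<dots> = (\<integral>\<^sup>+w. emeasure (distr M borel L) ((\<lambda>l. (l, w)) -` ?A) \<partial>distr M borel Y)"
    using A by (intro P.emeasure_pair_measure_alt2) (simp cong: sets_pair_measure_cong)
  also have "\<dots> = (\<integral>\<^sup>+w. ennreal (exp (- (exp (- x) * w))) \<partial>distr M borel Y)"
  proof (rule nn_integral_cong_AE)
    show "AE w in distr M borel Y. emeasure (distr M borel L) ((\<lambda>l. (l, w)) -` ?A) = ennreal (exp (- (exp (- x) * w)))"
      using pos
    proof eventually_elim
      case (elim w)
      have "emeasure (distr M borel L) ((\<lambda>l. (l, w)) -` ?A) = emeasure M {\<omega> \<in> space M. L \<omega> \<le> x - ln w}"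
        by (subst emeasure_distr) (auto simp: space_pair_measure algebra_simps intro!: arg_cong[where f = "emeasure M"])
      also have "\<dots> = ennreal (exp (- exp (- (x - ln w))))"
        by (simp only: emeasure_eq_measure gumbel)
      also have "exp (- (x - ln w)) = exp (- x) * w"
        using elim by (simp add: exp_diff exp_minus field_simps)
      finally show ?case .
    qed
  qed
  also have "\<dots> = ennreal (\<integral>w. exp (- (exp (- x) * w)) \<partial>distr M borel Y)"
    using pos by (intro nn_integral_eq_integral Y.integrable_const_bound[where B = 1]) auto
  finally show ?thesis
    by (simp add: emeasure_eq_measure)
qed

text \<open>The probability integral transform: a variable with continuous distribution function
  \<psi> becomes uniform when \<psi> is applied to it.\<close>

lemma (in limit_weight) distr_gumbel_mix_uniform:
  assumes "prob_space M" and ind: "prob_space.indep_var M borel L borel Y"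
    and gumbel: "\<And>x. measure M {\<omega> \<in> space M. L \<omega> \<le> x} = exp (- exp (- x))"
    and Y: "distr M borel Y = \<mu>"
  shows "distr M borel (\<lambda>\<omega>. gumbel_mix (L \<omega> + ln (Y \<omega>))) = unit_uniform"
proof -
  interpret prob_space M by fact
  have [measurable]: "random_variable borel L" "random_variable borel Y"
    using ind by (auto simp: indep_var_distribution_eq)
  define X where "X \<omega> = L \<omega> + ln (Y \<omega>)" for \<omega>
  have [measurable]: "random_variable borel X"
    unfolding X_def[abs_def] by measurable
  have cdf_X: "prob {\<omega> \<in> space M. X \<omega> \<le> x} = gumbel_mix x" for x
    using prob_gumbel_add_ln_le[OF ind gumbel, of x, unfolded Y, OF W_pos]
    by (simp add: X_def gumbel_mix_def laplace_def)
  interpret X: real_distribution "distr M borel X"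
    by (rule real_distribution_distr) simp
  have "cdf (distr M borel X) = gumbel_mix"
    by (auto simp: fun_eq_iff cdf_def measure_distr vimage_def Int_def conj_commute simp flip: cdf_X)
  \<comment> \<open>The limits come for free, since \<open>gumbel_mix\<close> is now known to be the
    distribution function of a real random variable.\<close>
  then have lims: "(gumbel_mix \<longlongrightarrow> 1) at_top" "(gumbel_mix \<longlongrightarrow> 0) at_bot"
    using X.cdf_lim_at_top_prob X.cdf_lim_at_bot by auto
  have uniform: "prob {\<omega> \<in> space M. gumbel_mix (X \<omega>) \<le> t} = (t - 0) / (1 - 0)" if t: "0 \<le> t" "t \<le> 1" for t
  proof -
    \<comment> \<open>The end points are separate because \<open>gumbel_mix\<close> does not attain
      0 or 1; in between, the intermediate value theorem provides a preimage \<open>c\<close> of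
      t.\<close>
    consider "t = 0" | "0 < t" "t < 1" | "t = 1"
      using t by linarith
    then show ?thesis
    proof cases
      case 1
      have "{\<omega> \<in> space M. gumbel_mix (X \<omega>) \<le> t} = {}"
        using gumbel_mix_pos 1 by (auto simp: not_le)
      then show ?thesis
        by (simp only: 1) simp
    next
      case 2
      obtain a where "gumbel_mix a < t"
        using order_tendstoD(2)[OF lims(2) \<open>0 < t\<close>] by (auto simp: eventually_at_bot_linorder)
      moreover obtain b where "t < gumbel_mix b"
        using order_tendstoD(1)[OF lims(1) \<open>t < 1\<close>] by (auto simp: eventually_at_top_linorder)
      moreover from calculation have "a \<le> b"
        using gumbel_mix_less_iff[of a b] by linarith
      ultimately obtain c where c: "gumbel_mix c = t"
        using IVT'[of gumbel_mix a t b] continuous_on_subset[OF continuous_gumbel_mix] by auto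
      have "{\<omega> \<in> space M. gumbel_mix (X \<omega>) \<le> t} = {\<omega> \<in> space M. X \<omega> \<le> c}"
        using gumbel_mix_less_iff by (auto simp flip: c simp: not_less[symmetric])
      then show ?thesis
        by (simp add: cdf_X c)
    next
      case 3
      then show ?thesis
        using gumbel_mix_le_1 prob_space by simp
    qed
  qed
  have "distributed M lborel (\<lambda>\<omega>. gumbel_mix (X \<omega>)) (\<lambda>t. indicator {0..1} t / measure lborel {0..1 :: real})"
    using uniform by (intro uniform_distrI_borel_atLeastAtMost) auto
  then have "distr M lborel (\<lambda>\<omega>. gumbel_mix (X \<omega>)) = unit_uniform"
    by (simp add: distributed_def unit_uniform_def ennreal_indicator)
  then show ?thesis
    by (simp add: X_def cong: distr_cong)
qed

section \<open>The generating function of the number of vertices below the threshold\<close>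

context limit_weight
begin

lemma biased_pgf_twice_bounds:
  "t \<in> {0..1} \<Longrightarrow> 0 \<le> biased_pgf (biased_pgf t) \<and> biased_pgf (biased_pgf t) \<le> t"
  using biased_pgf_le[of t] biased_pgf_le[of "biased_pgf t"] biased_pgf_mem[of t]
    biased_pgf_nonneg[of "biased_pgf t"] by auto

text \<open>By \<open>tree_degree_eq_card\<close> this is the tree degree minus one when
  \<open>v i\<close> is \<psi> of the i-th value of \<Lambda> + log W.\<close>

abbreviation fit_below :: "nat \<Rightarrow> (nat \<Rightarrow> real) \<Rightarrow> nat" where
  "fit_below k v \<equiv> card {i\<in>{..<k}. v i < biased_pgf (biased_pgf (MAX j\<in>{..<k}. v j))}"

lemma measurable_fit_below:
  "fit_below k \<in> measurable (PiM {..<k} (\<lambda>_. unit_uniform)) (count_space UNIV)"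
proof (cases "k = 0")
  case False
  then show ?thesis
    by measurable
qed simp

text \<open>Given D = k, \<open>expectation_power_card_below\<close> with g = F(F(.)) yields k times
  the integral of the power k - 1 of \<open>c t\<close>. Exchanging the integral with the average
  over k gives f'(c t).\<close>

lemma integral_power_fit_below:
  assumes z: "0 \<le> z" "z \<le> 1"
  shows "(\<integral>(k, v). z ^ (1 + fit_below k v) \<partial>(N \<Otimes>\<^sub>M PiM UNIV (\<lambda>_. unit_uniform))) =
    z * (LBINT t:{0..1}. pgf' N (t - (1 - z) * (pgf' N (pgf' N t / pgf' N 1) / pgf' N 1)))"
proof -
  interpret U: prob_space unit_uniform
    by (rule prob_space_unit_uniform)
  interpret NU: pair_prob_space N unit_uniform ..
  define c where "c t = t - (1 - z) * biased_pgf (biased_pgf t)" for t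
  have [measurable]: "c \<in> borel_measurable borel"
    unfolding c_def[abs_def] by measurable
  \<comment> \<open>The identification of \<open>pgf'\<close> with \<open>pgf_deriv\<close> and the
    bounds for Fubini need the argument to stay in the unit interval.\<close>
  have c_mem: "c t \<in> {0..1}" if "t \<in> {0..1}" for t
  proof -
    have "0 \<le> (1 - z) * biased_pgf (biased_pgf t)" "(1 - z) * biased_pgf (biased_pgf t) \<le> 1 * t"
      using biased_pgf_twice_bounds[OF that] z by (auto intro: mult_nonneg_nonneg order_trans[OF mult_left_le_one_le])
    with that show ?thesis
      by (auto simp: c_def)
  qed
  have AE_c: "AE t in unit_uniform. 0 \<le> c t ^ n \<and> c t ^ n \<le> 1" for n
    using AE_unit_uniform by eventually_elim (use c_mem in \<open>auto intro!: power_le_one\<close>)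
  have int_c: "integrable unit_uniform (\<lambda>t. real k * c t ^ n)" for k n
    using AE_c[of n] by (intro integrable_mult_right U.integrable_const_bound[where B = 1]) auto
  have "(\<integral>(k, v). z ^ (1 + fit_below k v) \<partial>(N \<Otimes>\<^sub>M PiM UNIV (\<lambda>_. unit_uniform))) =
      (\<integral>(k, v). z ^ (1 + fit_below k (restrict v {..<k})) \<partial>(N \<Otimes>\<^sub>M PiM UNIV (\<lambda>_. unit_uniform)))"
  proof (rule Bochner_Integration.integral_cong[OF refl], clarify)
    fix k and v :: "nat \<Rightarrow> real"
    have "(\<lambda>j\<in>{..<k}. v j) ` {..<k} = v ` {..<k}"
      by (rule image_restrict_eq)
    then have "{i\<in>{..<k}. v i < biased_pgf (biased_pgf (MAX j\<in>{..<k}. v j))} =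
        {i\<in>{..<k}. restrict v {..<k} i < biased_pgf (biased_pgf (MAX j\<in>{..<k}. restrict v {..<k} j))}"
      by auto
    then show "z ^ (1 + fit_below k v) = z ^ (1 + fit_below k (restrict v {..<k}))"
      by (simp only:)
  qed
  also have "\<dots> = (\<integral>k. \<integral>v. z ^ (1 + fit_below k v) \<partial>PiM {..<k} (\<lambda>_. unit_uniform) \<partial>N)"
  proof (rule integral_pair_PiM_nat[where B = 1])
    show "(\<lambda>v. z ^ (1 + fit_below k v)) \<in> borel_measurable (PiM {..<k} (\<lambda>_. unit_uniform))" for k
      by (rule measurable_compose[OF measurable_fit_below]) simp
    show "\<bar>z ^ (1 + fit_below k v)\<bar> \<le> 1" for k v
      using z by (simp add: power_abs abs_mult mult_le_one power_le_one)
  qed (auto simp: N.prob_space_axioms prob_space_unit_uniform)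
  also have "\<dots> = (\<integral>k. z * (\<integral>t. real k * c t ^ (k - 1) \<partial>unit_uniform) \<partial>N)"
  proof (rule integral_cong_AE)
    show "AE k in N. (\<integral>v. z ^ (1 + fit_below k v) \<partial>PiM {..<k} (\<lambda>_. unit_uniform)) =
        z * (\<integral>t. real k * c t ^ (k - 1) \<partial>unit_uniform)"
      using ge_3
    proof eventually_elim
      case (elim k)
      then have "(\<integral>v. z ^ fit_below k v \<partial>PiM {..<k} (\<lambda>_. unit_uniform)) =
          real k * (\<integral>t. c t ^ (k - 1) \<partial>unit_uniform)"
        unfolding c_def using biased_pgf_twice_bounds z by (intro expectation_power_card_below) auto
      then show ?case
        by simp
    qed
  qed auto
  also have "\<dots> = z * (\<integral>k. \<integral>t. real k * c t ^ (k - 1) \<partial>unit_uniform \<partial>N)"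
    by simp
  also have "(\<integral>k. \<integral>t. real k * c t ^ (k - 1) \<partial>unit_uniform \<partial>N) =
      (\<integral>t. \<integral>k. real k * c t ^ (k - 1) \<partial>N \<partial>unit_uniform)"
  proof (rule NU.Fubini_integral[symmetric])
    have "(\<lambda>(k, t). real k * c t ^ (k - 1)) \<in> borel_measurable (count_space UNIV \<Otimes>\<^sub>M unit_uniform)"
      by (intro measurable_pair_measure_countable1) auto
    then have meas: "(\<lambda>(k, t). real k * c t ^ (k - 1)) \<in> borel_measurable (N \<Otimes>\<^sub>M unit_uniform)"
      by (subst measurable_cong_sets[OF sets_pair_measure_cong[OF sets_N refl] refl])
    \<comment> \<open>The inner integral is at most k because 0 \<le> \<open>c t\<close> \<le> 1,
      and D has finite mean.\<close>
    have "integrable N (\<lambda>k. \<integral>t. norm (real k * c t ^ (k - 1)) \<partial>unit_uniform)"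
    proof (rule Bochner_Integration.integrable_bound[OF integrable_N])
      have "(\<integral>t. \<bar>real k * c t ^ (k - 1)\<bar> \<partial>unit_uniform) \<le> real k" for k
        using AE_c[of "k - 1"]
        by (intro U.integral_le_const integrable_abs int_c) (auto simp: abs_mult mult_left_le)
      then show "AE k in N. norm (\<integral>t. norm (real k * c t ^ (k - 1)) \<partial>unit_uniform) \<le> norm (real k)"
        by simp
    qed simp
    with meas int_c show "integrable (N \<Otimes>\<^sub>M unit_uniform) (\<lambda>(k, t). real k * c t ^ (k - 1))"
      by (intro NU.Fubini_integrable) auto
  qed
  also have "\<dots> = (\<integral>t. pgf_deriv (c t) \<partial>unit_uniform)"
    by (simp add: pgf_deriv_def)
  also have "\<dots> = (LBINT t:{0..1}. pgf_deriv (c t))"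
    by (rule integral_unit_uniform) measurable
  also have "\<dots> = (LBINT t:{0..1}. pgf' N (t - (1 - z) * (pgf' N (pgf' N t / pgf' N 1) / pgf' N 1)))"
  proof (intro set_lebesgue_integral_cong allI impI)
    fix t :: real assume t: "t \<in> {0..1}"
    have bp: "pgf' N u / pgf' N 1 = biased_pgf u" if "u \<in> {0..1}" for u
      using that by (simp add: pgf'_eq biased_pgf_def pgf_deriv_1)
    show "pgf_deriv (c t) = pgf' N (t - (1 - z) * (pgf' N (pgf' N t / pgf' N 1) / pgf' N 1))"
      using pgf'_eq[OF c_mem[OF t]] t by (simp only: bp biased_pgf_mem c_def)
  qed simp
  finally show ?thesis .
qed

end

section \<open>The joint law of the degree and the uniform variables, and the conclusion\<close>

text \<open>\<open>indep_var_compose\<close> requires both images to have the same type.\<close>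

lemma (in prob_space) distr_pair_of_indep_var:
  assumes ind: "indep_var S X T Y" and f: "f \<in> measurable S S'" and g: "g \<in> measurable T T'"
  shows "distr M (S' \<Otimes>\<^sub>M T') (\<lambda>\<omega>. (f (X \<omega>), g (Y \<omega>))) =
    distr M S' (\<lambda>\<omega>. f (X \<omega>)) \<Otimes>\<^sub>M distr M T' (\<lambda>\<omega>. g (Y \<omega>))"
proof -
  have X: "random_variable S X" and Y: "random_variable T Y"
    and joint: "distr M S X \<Otimes>\<^sub>M distr M T Y = distr M (S \<Otimes>\<^sub>M T) (\<lambda>\<omega>. (X \<omega>, Y \<omega>))"
    using ind by (simp_all add: indep_var_distribution_eq)
  have "distr M S' (\<lambda>\<omega>. f (X \<omega>)) \<Otimes>\<^sub>M distr M T' (\<lambda>\<omega>. g (Y \<omega>)) =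
      distr (distr M S X) S' f \<Otimes>\<^sub>M distr (distr M T Y) T' g"
    by (simp add: distr_distr[OF f X] distr_distr[OF g Y] comp_def)
  also have "\<dots> = distr (distr M (S \<Otimes>\<^sub>M T) (\<lambda>\<omega>. (X \<omega>, Y \<omega>))) (S' \<Otimes>\<^sub>M T') (\<lambda>(x, y). (f x, g y))"
    unfolding joint[symmetric] using f g Y
    by (intro pair_measure_distr prob_space_imp_sigma_finite prob_space.prob_space_distr prob_space_distr) auto
  also have "\<dots> = distr M (S' \<Otimes>\<^sub>M T') (\<lambda>\<omega>. (f (X \<omega>), g (Y \<omega>)))"
    using f g X Y by (subst distr_distr) (auto simp: comp_def)
  finally show ?thesis
    by simp
qed

theorem theorem2p11:
  fixes M :: "'a measure" and D :: "'a \<Rightarrow> nat"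
    and \<Lambda> W :: "nat \<Rightarrow> 'a \<Rightarrow> real"
    and lam :: real and \<mu> :: "real measure"
    and N :: "nat measure" and Dhat :: "'a \<Rightarrow> nat"
  assumes "prob_space M"
    and "D \<in> measurable M (count_space UNIV)"
    and "N = distr M (count_space UNIV) D"
    and "AE \<omega> in M. 3 \<le> D \<omega>"
    and "integrable M (\<lambda>\<omega>. (real (D \<omega>))\<^sup>2 * ln (real (D \<omega>)))"
    and "exp (- lam) = 1 / mean_offspring N"
    and "W_law N lam \<mu>"
    and "prob_space.indep_vars M (\<lambda>_. borel)
           (\<lambda>v. case v of Deg \<Rightarrow> (\<lambda>\<omega>. real (D \<omega>)) | Gumbel i \<Rightarrow> \<Lambda> i | Weight i \<Rightarrow> W i) UNIV"
    and "\<And>i x. measure M {\<omega> \<in> space M. \<Lambda> i \<omega> \<le> x} = exp (- exp (- x))"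
    and "\<And>i. distr M borel (W i) = \<mu>"
    and "\<And>\<omega>. Dhat \<omega> = tree_degree lam (D \<omega>) (\<lambda>i. \<Lambda> i \<omega>) (\<lambda>i. W i \<omega>)"
  shows "distr M (count_space UNIV) Dhat = measure_pmf (bfs_degree_law N) \<and>
    (\<forall>z\<in>{0..1}.
       (\<integral>\<omega>. z ^ Dhat \<omega> \<partial>M) =
       z * (LBINT t:{0..1}.
              pgf' N (t - (1 - z) * (pgf' N (pgf' N t / pgf' N 1) / pgf' N 1))))"
proof -
  interpret M: prob_space M by fact
  note D [measurable] = assms(2) and N_eq = assms(3) and ind = assms(8)
  define X where "X v = (case v of Deg \<Rightarrow> (\<lambda>\<omega>. real (D \<omega>)) | Gumbel i \<Rightarrow> \<Lambda> i | Weight i \<Rightarrow> W i)" for v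
  have indX: "M.indep_vars (\<lambda>_. borel) X UNIV"
    using ind by (simp add: X_def[abs_def])
  have X_simps: "X Deg = (\<lambda>\<omega>. real (D \<omega>))" "X (Gumbel i) = \<Lambda> i" "X (Weight i) = W i" for i
    by (simp_all add: X_def)
  \<comment> \<open>As D \<ge> 3 exceeds e, ln D is at least 1 and D is dominated by the given
    moment; hence D has finite mean.\<close>
  have "AE \<omega> in M. norm (real (D \<omega>)) \<le> norm ((real (D \<omega>))\<^sup>2 * ln (real (D \<omega>)))"
    using assms(4)
  proof eventually_elim
    case (elim \<omega>)
    then have "1 \<le> ln (real (D \<omega>))"
      using exp_le by (subst ln_ge_iff) auto
    moreover have "real (D \<omega>) \<le> (real (D \<omega>))\<^sup>2"
      using elim by (simp add: power2_eq_square)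
    ultimately show ?case
      using mult_mono[of "real (D \<omega>)" "(real (D \<omega>))\<^sup>2" 1 "ln (real (D \<omega>))"] by simp
  qed
  then have int_D: "integrable M (\<lambda>\<omega>. real (D \<omega>))"
    by (intro Bochner_Integration.integrable_bound[OF assms(5)]) simp_all
  have prob_N: "prob_space N"
    unfolding N_eq by (rule M.prob_space_distr[OF D])
  interpret limit_weight N lam \<mu>
  proof (intro limit_weight.intro degree_distribution.intro prob_N
      degree_distribution_axioms.intro limit_weight_axioms.intro assms(7))
    show "sets N = sets (count_space UNIV)"
      by (simp add: N_eq)
    show "AE k in N. 3 \<le> k"
      using assms(4) unfolding N_eq by (subst AE_distr_iff[OF D]) simp_all
    show "integrable N real"
      using int_D unfolding N_eq by (subst integrable_distr_eq[OF D]) simp_all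
  qed
  define V where "V i \<omega> = gumbel_mix (\<Lambda> i \<omega> + ln (W i \<omega>))" for i \<omega>
  have indV: "M.indep_vars (\<lambda>_. borel) V UNIV"
  proof -
    \<comment> \<open>The index blocks are disjoint for different i, so functions of separate blocks
      are independent.\<close>
    have "M.indep_vars (\<lambda>i. PiM {Gumbel i, Weight i} (\<lambda>_. borel))
        (\<lambda>i \<omega>. restrict (\<lambda>v. X v \<omega>) {Gumbel i, Weight i}) UNIV"
      by (rule M.indep_vars_restrict[OF indX]) (auto simp: disjoint_family_on_def)
    then have "M.indep_vars (\<lambda>_. borel) (\<lambda>i \<omega>. gumbel_mix
        (restrict (\<lambda>v. X v \<omega>) {Gumbel i, Weight i} (Gumbel i) +
         ln (restrict (\<lambda>v. X v \<omega>) {Gumbel i, Weight i} (Weight i)))) UNIV"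
      by (rule M.indep_vars_compose2[where Y = "\<lambda>i x. gumbel_mix (x (Gumbel i) + ln (x (Weight i)))"]) measurable
    then show ?thesis
      by (simp add: V_def[abs_def] X_simps)
  qed
  have V [measurable]: "M.random_variable borel (V i)" for i
    using indV by (simp add: M.indep_vars_def)
  have distr_V: "distr M borel (V i) = unit_uniform" for i
  proof -
    have "M.indep_var borel (\<Lambda> i) borel (W i)"
      using M.indep_var_compose[OF M.indep_var_restrict[OF indX, of "{Gumbel i}" "{Weight i}"],
          of "\<lambda>x. x (Gumbel i)" borel "\<lambda>x. x (Weight i)" borel]
      by (simp add: comp_def X_simps)
    then show ?thesis
      unfolding V_def[abs_def] using assms(1,9,10) by (intro distr_gumbel_mix_uniform)
  qed
  have distr_V_PiM: "distr M (PiM UNIV (\<lambda>_. borel)) (\<lambda>\<omega> i. V i \<omega>) = PiM UNIV (\<lambda>_. unit_uniform)"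
    using M.indep_vars_iff_distr_eq_PiM'[of UNIV V "\<lambda>_. borel"] indV by (simp add: distr_V restrict_def)
  have joint: "distr M (count_space UNIV \<Otimes>\<^sub>M PiM UNIV (\<lambda>_. borel)) (\<lambda>\<omega>. (D \<omega>, \<lambda>i. V i \<omega>)) =
      N \<Otimes>\<^sub>M PiM UNIV (\<lambda>_. unit_uniform)"
  proof -
    have "M.indep_var (PiM {Deg} (\<lambda>_. borel)) (\<lambda>\<omega>. restrict (\<lambda>v. X v \<omega>) {Deg})
        (PiM (- {Deg}) (\<lambda>_. borel)) (\<lambda>\<omega>. restrict (\<lambda>v. X v \<omega>) (- {Deg}))"
      by (rule M.indep_var_restrict[OF indX]) auto
    \<comment> \<open>The independent family contains D as a real number; the floor recovers the
      natural number.\<close>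
    moreover have "(\<lambda>x. nat \<lfloor>x Deg\<rfloor>) \<in> measurable (PiM {Deg} (\<lambda>_. borel :: real measure)) (count_space UNIV)"
    proof -
      have "(\<lambda>x. x Deg) \<in> measurable (PiM {Deg} (\<lambda>_. borel :: real measure)) borel"
        by (rule measurable_component_singleton) simp
      from measurable_compose[OF this measurable_real_floor] show ?thesis
        by (rule measurable_compose) simp
    qed
    moreover have "(\<lambda>x i. gumbel_mix (x (Gumbel i) + ln (x (Weight i))))
        \<in> measurable (PiM (- {Deg}) (\<lambda>_. borel)) (PiM UNIV (\<lambda>_. borel))"
      by (rule measurable_PiM_single') auto
    ultimately have "distr M (count_space UNIV \<Otimes>\<^sub>M PiM UNIV (\<lambda>_. borel))
        (\<lambda>\<omega>. (nat \<lfloor>restrict (\<lambda>v. X v \<omega>) {Deg} Deg\<rfloor>, \<lambda>i. gumbel_mix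
          (restrict (\<lambda>v. X v \<omega>) (- {Deg}) (Gumbel i) + ln (restrict (\<lambda>v. X v \<omega>) (- {Deg}) (Weight i))))) =
      distr M (count_space UNIV) (\<lambda>\<omega>. nat \<lfloor>restrict (\<lambda>v. X v \<omega>) {Deg} Deg\<rfloor>) \<Otimes>\<^sub>M
      distr M (PiM UNIV (\<lambda>_. borel)) (\<lambda>\<omega> i. gumbel_mix
        (restrict (\<lambda>v. X v \<omega>) (- {Deg}) (Gumbel i) + ln (restrict (\<lambda>v. X v \<omega>) (- {Deg}) (Weight i))))"
      by (rule M.distr_pair_of_indep_var)
    then show ?thesis
      by (simp add: X_simps V_def flip: distr_V_PiM N_eq)
  qed
  have Dhat_eq: "Dhat \<omega> = 1 + fit_below (D \<omega>) (\<lambda>i. V i \<omega>)" for \<omega>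
    by (simp add: assms(11) tree_degree_eq_card V_def)
  have meas: "(\<lambda>(k, v). 1 + fit_below k v) \<in> measurable (count_space UNIV \<Otimes>\<^sub>M PiM UNIV (\<lambda>_. borel)) (count_space UNIV)"
  proof (rule measurable_pair_measure_countable1)
    fix k :: nat
    have "(\<lambda>v. 1 + fit_below k v) \<in> measurable (PiM UNIV (\<lambda>_. borel)) (count_space UNIV)"
    proof (cases "k = 0")
      case False
      then show ?thesis
        by measurable
    qed simp
    then show "(\<lambda>v. case (k, v) of (k, v) \<Rightarrow> 1 + fit_below k v)
        \<in> measurable (PiM UNIV (\<lambda>_. borel)) (count_space UNIV)"
      by (simp only: prod.case)
  qed simp
  have DV: "(\<lambda>\<omega>. (D \<omega>, \<lambda>i. V i \<omega>)) \<in> measurable M (count_space UNIV \<Otimes>\<^sub>M PiM UNIV (\<lambda>_. borel))"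
    by (intro measurable_Pair D measurable_PiM_single') auto
  have Dhat [measurable]: "Dhat \<in> measurable M (count_space UNIV)"
    using measurable_compose[OF DV meas] by (simp add: Dhat_eq[abs_def])
  have E_Dhat: "(\<integral>\<omega>. z ^ Dhat \<omega> \<partial>M) =
      z * (LBINT t:{0..1}. pgf' N (t - (1 - z) * (pgf' N (pgf' N t / pgf' N 1) / pgf' N 1)))"
    if "z \<in> {0..1}" for z
  proof -
    have "(\<integral>\<omega>. z ^ Dhat \<omega> \<partial>M) = (\<integral>(k, v). z ^ (1 + fit_below k v)
        \<partial>distr M (count_space UNIV \<Otimes>\<^sub>M PiM UNIV (\<lambda>_. borel)) (\<lambda>\<omega>. (D \<omega>, \<lambda>i. V i \<omega>)))"
      using measurable_compose[OF meas, of "\<lambda>n. z ^ n" borel]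
      by (subst integral_distr[OF DV]) (simp_all add: case_prod_beta Dhat_eq)
    then show ?thesis
      using integral_power_fit_below[of z] that by (simp only: joint) simp
  qed
  interpret Dhat: prob_space "distr M (count_space UNIV) Dhat"
    by (rule M.prob_space_distr) simp
  define q where "q = Abs_pmf (distr M (count_space UNIV) Dhat)"
  have q: "measure_pmf q = distr M (count_space UNIV) Dhat"
    unfolding q_def
  proof (rule Abs_pmf_inverse, safe)
    \<comment> \<open>On a countable discrete space almost every point has positive mass.\<close>
    show "AE x in distr M (count_space UNIV) Dhat. measure (distr M (count_space UNIV) Dhat) {x} \<noteq> 0"
      by (subst Dhat.AE_support_countable) (auto intro!: exI[of _ UNIV])
  qed (simp_all add: Dhat.prob_space_axioms)
  have pgf_q: "pgf q z = bfs_degree_pgf N z" if "z \<in> {0..1}" for z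
    using E_Dhat[OF that] by (simp add: q pgf_def integral_distr bfs_degree_pgf_def)
  have "bfs_degree_law N = q"
    unfolding bfs_degree_law_def
  proof (rule the_equality)
    \<comment> \<open>\<open>pgf_inject\<close> supplies the uniqueness on which the definite
      description in \<open>bfs_degree_law\<close> rests.\<close>
    show "r = q" if "\<forall>z\<in>{0..1}. pgf (measure_pmf r) z = bfs_degree_pgf N z" for r
      using that pgf_q by (intro pgf_inject) auto
  qed (use pgf_q in auto)
  then show ?thesis
    using E_Dhat q by simp
qed

end
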